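(* Let $n\ge 6$ be even with $n\not\equiv 0\pmod 3$, and let $n=p+q$ with $p,q$ prime. (1) If $n\equiv 1\pmod 3$ and $p$ is an upper member, then $p=5$ or $q=3$. (2) If $n\equiv 2\pmod 3$ and $p$ is a lower member, then $p=3$ or $q=3$. Consequently, apart from these exceptions involving the primes $3$ and $5$, all twin members in Goldbach partitions of $n$ are lower members (and not upper members) when $n\equiv 1\pmod 3$, and upper members (and not lower members) when $n\equiv 2\pmod 3$; that is, if $p$ is a twin member, then: for $n\equiv 1\pmod 3$, $p\ne 5$ and $q\neq 3$ imply that $p$ is a lower and not an upper member; for $n\equiv 2\pmod 3$, $p\ne 3$ and $q\ne 3$ imply that $p$ is an upper and not a lower member.
   Context: A prime $t$ is a twin member if $t-2$ or $t+2$ is prime. A twin member $t$ is a lower member if $t+2$ is prime, and an upper member if $t-2$ is prime (a twin member may be both, e.g. $5$). A Goldbach partition of an even $n$ is an unordered pair $\{p,q\}$ of primes with $p+q=n$. *)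

theory Defs
  imports "HOL-Number_Theory.Cong"
begin

(* Truncated subtraction is harmless here: for t < 2 both t - 2 and t fail to be prime,
   and otherwise t - 2 is the true difference. *)

definition twin_member :: "nat \<Rightarrow> bool" where
  "twin_member t \<longleftrightarrow> prime t \<and> (prime (t - 2) \<or> prime (t + 2))"

definition lower_member :: "nat \<Rightarrow> bool" where
  "lower_member t \<longleftrightarrow> twin_member t \<and> prime (t + 2)"

definition upper_member :: "nat \<Rightarrow> bool" where
  "upper_member t \<longleftrightarrow> twin_member t \<and> prime (t - 2)"

end

theory Submission
  imports Defs
begin

text \<open>
  Everything happens modulo 3, where the only prime divisible by 3 is 3 itself. For \<^term>\<open>t \<ge> 2\<close>,
  of the three pairwise incongruent numbers \<^term>\<open>t - 2\<close>, \<^term>\<open>t\<close>, \<^term>\<open>t + 2\<close> exactly one is a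
  multiple of 3, so if two of them are prime and neither is 3, the multiple is the third one, and
  this fixes the residue of \<^term>\<open>t\<close>: an upper member other than 5 is 1 modulo 3
  (\<open>upper_member_mod_3\<close>), a lower member other than 3 is 2 modulo 3 (\<open>lower_member_mod_3\<close>).
  If that residue equals the residue of \<^term>\<open>n = p + q\<close>, then 3 divides \<^term>\<open>q\<close>, whence
  \<^term>\<open>q = 3\<close>. The concluding classification follows because a twin member is lower or upper,
  and outside the exceptional cases the residue of \<^term>\<open>n\<close> excludes one of the two.
\<close>

lemma prime_mod_3_eq_0:
  fixes p :: nat
  assumes "prime p" and "p mod 3 = 0"
  shows "p = 3"
  using assms by (metis mod_0_imp_dvd numeral_eq_one_iff prime_nat_iff semiring_norm(84))

text \<open>
  The exception is 5 alone: it is the upper member above the prime 3, while 3 itself is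
  no upper member because 1 is not prime.
\<close>

lemma upper_member_mod_3:
  assumes "upper_member t" and "t \<noteq> 5"
  shows "t mod 3 = 1"
proof -
  have t: "prime t" and t': "prime (t - 2)"
    using assms(1) by (auto simp: upper_member_def twin_member_def)
  have "t - 2 \<ge> 2"
    using t' by (rule prime_ge_2_nat)
  then have "t mod 3 \<noteq> 0"
    using prime_mod_3_eq_0 [OF t] by linarith
  moreover have "t mod 3 \<noteq> 2"
  proof
    assume "t mod 3 = 2"
    with \<open>t - 2 \<ge> 2\<close> have "(t - 2) mod 3 = 0" by presburger
    with prime_mod_3_eq_0 [OF t'] assms(2) show False by linarith
  qed
  ultimately show ?thesis by linarith
qed

lemma lower_member_mod_3:
  assumes "lower_member t" and "t \<noteq> 3"
  shows "t mod 3 = 2"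
proof -
  have t: "prime t" and t': "prime (t + 2)"
    using assms(1) by (auto simp: lower_member_def twin_member_def)
  have "t mod 3 \<noteq> 0"
    using prime_mod_3_eq_0 [OF t] assms(2) by blast
  moreover have "t mod 3 \<noteq> 1"
  proof
    assume "t mod 3 = 1"
    then have "(t + 2) mod 3 = 0" by presburger
    with prime_mod_3_eq_0 [OF t'] prime_ge_2_nat [OF t] show False by linarith
  qed
  ultimately show ?thesis by linarith
qed

lemma prime_summand_eq_3:
  fixes p q :: nat
  assumes "prime q" and "[p + q = p] (mod 3)"
  shows "q = 3"
  using assms prime_mod_3_eq_0 [of q] by (simp only: cong_add_lcancel_0_nat) (simp add: cong_def)

theorem proposition3:
  fixes n p q :: nat
  assumes "n \<ge> 6" and "even n" and "\<not> [n = 0] (mod 3)"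
    and "prime p" and "prime q" and "n = p + q"
  shows "([n = 1] (mod 3) \<and> upper_member p \<longrightarrow> p = 5 \<or> q = 3)
    \<and> ([n = 2] (mod 3) \<and> lower_member p \<longrightarrow> p = 3 \<or> q = 3)
    \<and> (twin_member p \<longrightarrow>
        ([n = 1] (mod 3) \<and> p \<noteq> 5 \<and> q \<noteq> 3 \<longrightarrow> lower_member p \<and> \<not> upper_member p)
      \<and> ([n = 2] (mod 3) \<and> p \<noteq> 3 \<and> q \<noteq> 3 \<longrightarrow> upper_member p \<and> \<not> lower_member p))"
proof -
  have upper: "p = 5 \<or> q = 3" if "[n = 1] (mod 3)" "upper_member p"
    using that upper_member_mod_3 [of p] prime_summand_eq_3 [OF assms(5), of p] assms(6)
    by (fastforce simp: cong_def)
  have lower: "p = 3 \<or> q = 3" if "[n = 2] (mod 3)" "lower_member p"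
    using that lower_member_mod_3 [of p] prime_summand_eq_3 [OF assms(5), of p] assms(6)
    by (fastforce simp: cong_def)
  have "lower_member p \<or> upper_member p" if "twin_member p"
    using that by (auto simp: twin_member_def lower_member_def upper_member_def)
  with upper lower show ?thesis by blast
qed

end
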